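(* Let $P$ be a Schröder path and let $(x,z)\in\mathbb{Z}^2$ be a point on $P$ with $z>x+1$ such that the bounce path of $P$ at $(x,z)$ has exactly one bounce point and the bounce decomposition of $P$ at $(x,z)$ is $P=U\mathtt{n}\cdot\mathtt{n}V\mathtt{d}\cdot\mathtt{e}W$. Then $\mathrm{G}_P(\mathbf{x};q)=q\,\mathrm{G}_{U\mathtt{n}\mathtt{n}V\mathtt{e}\mathtt{d}W}(\mathbf{x};q)$.
   Context: Steps: $\mathtt{n}=(0,1)$, $\mathtt{e}=(1,0)$, $\mathtt{d}=(1,1)$. A Schröder path of size $n$ is a lattice path from $(0,0)$ to $(n,n)$ with steps in $\{\mathtt{n},\mathtt{e},\mathtt{d}\}$ such that every east and every diagonal step is preceded by strictly more north steps than east steps; paths are words in $\{\mathtt{n},\mathtt{d},\mathtt{e}\}^*$. Bounce path of $P$ (size $n$) at a lattice point $(u_1,u_0)$ on $P$: move south from $(u_1,u_0)$ to $(u_1,u_1)$, then west until first reaching a point $(u_2,u_1)$ of $P$; if that point lies between two diagonal steps of $P$, continue south to $(u_2,u_2)$ and west to a point $(u_3,u_2)$ of $P$, and so on, stopping at the first point $(u_{k+1},u_k)$ incident to a north or east step of $P$. The points $(u_i,u_i)$ are the bounce points. The bounce decomposition at $(u_1,u_0)$ is the unique factorisation $P=Us_1\cdot s_2Vs_3\cdot s_4W$ ($s_i$ single steps) where $Us_1$ is the part of $P$ from $(0,0)$ to $(u_{k+1},u_k)$ and $s_4W$ is the part from $(u_1,u_0)$ to $(n,n)$; dots are only markers.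 $\Gamma_P$ is the graph on $[n]$ where, for $1\le a<b\le n$, $\{a,b\}$ is a non-strict edge if the unit square $[a-1,a]\times[b-1,b]$ lies in the region between $P$ and the line $y=x$, and a strict edge if $P$ has a diagonal step from $(a-1,b-1)$ to $(a,b)$. A coloring is a map $\kappa:[n]\to\mathbb{Z}_{>0}$ with $\kappa(a)<\kappa(b)$ for each strict edge $\{a,b\}$, $a<b$; $\mathrm{asc}(\kappa)$ is the number of non-strict edges $\{a,b\}$, $a<b$, with $\kappa(a)<\kappa(b)$. $\mathrm{G}_P(\mathbf{x};q)=\sum_\kappa q^{\mathrm{asc}(\kappa)}x_{\kappa(1)}\cdots x_{\kappa(n)}$ over all colorings. *)

theory Defs
  imports
    "HOL-Analysis.Analysis"
    "HOL-Library.Multiset"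
    "HOL-Computational_Algebra.Polynomial"
begin

datatype step = North | East | Diag

fun step_vec :: "step \<Rightarrow> int \<times> int" where
  "step_vec North = (0, 1)"
| "step_vec East = (1, 0)"
| "step_vec Diag = (1, 1)"

text \<open>\<open>pos w i\<close> is the point reached from the origin after the first \<open>i\<close> steps of the word \<open>w\<close>.\<close>

definition pos :: "step list \<Rightarrow> nat \<Rightarrow> int \<times> int" where
  "pos w i = (\<Sum>s\<leftarrow>take i w. step_vec s)"

definition endpoint :: "step list \<Rightarrow> int \<times> int" where
  "endpoint w = pos w (length w)"

definition schroeder_path :: "nat \<Rightarrow> step list \<Rightarrow> bool" where
  "schroeder_path n P \<longleftrightarrow>
     endpoint P = (int n, int n) \<and>
     (\<forall>i<length P. P ! i \<noteq> North \<longrightarrow>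
        count_list (take i P) North > count_list (take i P) East)"

text \<open>All lattice points on a path are step endpoints, since no step has a lattice point
  in its interior.\<close>

definition lattice_points :: "step list \<Rightarrow> (int \<times> int) set" where
  "lattice_points P = pos P ` {..length P}"

definition between_diags :: "step list \<Rightarrow> int \<times> int \<Rightarrow> bool" where
  "between_diags P p \<longleftrightarrow>
     (\<exists>i. Suc i < length P \<and> P ! i = Diag \<and> P ! Suc i = Diag \<and> pos P (Suc i) = p)"

definition incident_NE :: "step list \<Rightarrow> int \<times> int \<Rightarrow> bool" where
  "incident_NE P p \<longleftrightarrow>
     (\<exists>i<length P. P ! i \<in> {North, East} \<and> (p = pos P i \<or> p = pos P (Suc i)))"

text \<open>\<open>(w, v)\<close> is the first point of \<open>P\<close> met when going west from \<open>(v, v)\<close>, with \<open>(v, v)\<close>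
  itself allowed. On a line of integral height \<open>P\<close> consists of lattice points and whole east
  steps, so it suffices to look at lattice points.\<close>

definition first_west :: "step list \<Rightarrow> int \<Rightarrow> int \<Rightarrow> bool" where
  "first_west P v w \<longleftrightarrow>
     w \<le> v \<and> (w, v) \<in> lattice_points P \<and>
     (\<forall>w'. w < w' \<and> w' \<le> v \<longrightarrow> (w', v) \<notin> lattice_points P)"

text \<open>The bounce path is recorded by its coordinates \<open>u 0, \<dots>, u (k + 1)\<close> in the usual
  numbering: it starts at \<open>(u 1, u 0)\<close>, visits \<open>(u i, u i)\<close> and then \<open>(u (i + 1), u i)\<close>
  for \<open>i = 1, \<dots>, k\<close>, and stops at \<open>(u (k + 1), u k)\<close>. Other values of \<open>u\<close> are irrelevant.\<close>

definition bounce_path :: "step list \<Rightarrow> int \<times> int \<Rightarrow> nat \<Rightarrow> (nat \<Rightarrow> int) \<Rightarrow> bool" where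
  "bounce_path P p k u \<longleftrightarrow>
     p \<in> lattice_points P \<and> p = (u 1, u 0) \<and> 1 \<le> k \<and>
     (\<forall>i\<in>{1..k}. first_west P (u i) (u (i + 1))) \<and>
     (\<forall>i\<in>{1..<k}. between_diags P (u (i + 1), u i)) \<and>
     incident_NE P (u (k + 1), u k)"

definition bounce_points :: "nat \<Rightarrow> (nat \<Rightarrow> int) \<Rightarrow> (int \<times> int) set" where
  "bounce_points k u = (\<lambda>i. (u i, u i)) ` {1..k}"

definition bounce_decomposition ::
  "step list \<Rightarrow> nat \<Rightarrow> (nat \<Rightarrow> int) \<Rightarrow>
   step list \<Rightarrow> step \<Rightarrow> step \<Rightarrow> step list \<Rightarrow> step \<Rightarrow> step \<Rightarrow> step list \<Rightarrow> bool" where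
  "bounce_decomposition P k u U s1 s2 V s3 s4 W \<longleftrightarrow>
     P = U @ [s1] @ [s2] @ V @ [s3] @ [s4] @ W \<and>
     endpoint (U @ [s1]) = (u (k + 1), u k) \<and>
     endpoint (U @ [s1] @ [s2] @ V @ [s3]) = (u 1, u 0)"

definition path_curve :: "step list \<Rightarrow> (real \<times> real) set" where
  "path_curve P =
     (\<Union>i<length P. closed_segment
        (map_prod of_int of_int (pos P i)) (map_prod of_int of_int (pos P (Suc i))))"

definition region :: "step list \<Rightarrow> (real \<times> real) set" where
  "region P = {(s, t). s \<le> t \<and> (\<exists>t'. t \<le> t' \<and> (s, t') \<in> path_curve P)}"

definition nonstrict_edges :: "nat \<Rightarrow> step list \<Rightarrow> (nat \<times> nat) set" where
  "nonstrict_edges n P =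
     {(a, b). 1 \<le> a \<and> a < b \<and> b \<le> n \<and>
        {real a - 1..real a} \<times> {real b - 1..real b} \<subseteq> region P}"

definition strict_edges :: "nat \<Rightarrow> step list \<Rightarrow> (nat \<times> nat) set" where
  "strict_edges n P =
     {(a, b). 1 \<le> a \<and> a < b \<and> b \<le> n \<and>
        (\<exists>i<length P. P ! i = Diag \<and> pos P i = (int a - 1, int b - 1))}"

definition colorings :: "nat \<Rightarrow> step list \<Rightarrow> (nat \<Rightarrow> nat) set" where
  "colorings n P =
     {\<kappa> \<in> {1..n} \<rightarrow>\<^sub>E {0<..}. \<forall>(a, b)\<in>strict_edges n P. \<kappa> a < \<kappa> b}"

definition asc :: "nat \<Rightarrow> step list \<Rightarrow> (nat \<Rightarrow> nat) \<Rightarrow> nat" where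
  "asc n P \<kappa> = card {(a, b) \<in> nonstrict_edges n P. \<kappa> a < \<kappa> b}"

text \<open>A formal power series in \<open>x\<^sub>1, x\<^sub>2, \<dots>\<close> over \<open>\<int>[q]\<close> is the function giving the
  coefficient of each monomial. The monomial \<open>x\<^sub>i \<cdots> x\<^sub>j\<close> is the multiset \<open>{#i, \<dots>, j#}\<close>, and
  \<open>monom 1 d\<close> is \<open>q\<^sup>d\<close>. The colorings contributing to a fixed monomial take values in the
  support of that multiset, so the sum below is finite.\<close>

definition G_series :: "nat \<Rightarrow> step list \<Rightarrow> nat multiset \<Rightarrow> int poly" where
  "G_series n P m =
     (\<Sum>\<kappa> | \<kappa> \<in> colorings n P \<and> image_mset \<kappa> (mset_set {1..n}) = m. monom 1 (asc n P \<kappa>))"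

end

theory Submission
  imports Defs "HOL-Combinatorics.Transposition"
begin

text \<open>Since there is one bounce point, \<open>P\<close> passes through \<open>(y, x)\<close> between two north steps for some
  \<open>y\<close>, so in \<open>\<Gamma>\<^sub>P\<close> the vertices \<open>x\<close> and \<open>x + 1\<close> have the same smaller neighbours, all of them
  non-strict. Their larger neighbours also agree, except that \<open>(x, z)\<close> is strict and \<open>(x + 1, z)\<close> is
  non-strict for \<open>P\<close>, whereas \<open>(x, z)\<close> is absent and \<open>(x + 1, z)\<close> is strict for the other path.
  A coloring with \<open>\<kappa> x < \<kappa> z\<close> and \<open>\<kappa> (x + 1) < \<kappa> z\<close> is admissible for both paths and has one more
  ascent for \<open>P\<close>. In the remaining colorings of \<open>P\<close>, exchanging the colors of \<open>x\<close> and \<open>x + 1\<close> gives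
  the remaining colorings of the other path and destroys exactly the ascent \<open>(x, x + 1)\<close>.\<close>

section \<open>Words as sets of steps with their starting points\<close>

fun steps_at :: "int \<times> int \<Rightarrow> step list \<Rightarrow> ((int \<times> int) \<times> step) set" where
  "steps_at p [] = {}"
| "steps_at p (s # w) = insert (p, s) (steps_at (p + step_vec s) w)"

lemma endpoint_Nil [simp]: "endpoint [] = 0"
  by (simp add: endpoint_def pos_def)

lemma endpoint_Cons [simp]: "endpoint (s # w) = step_vec s + endpoint w"
  by (simp add: endpoint_def pos_def)

lemma endpoint_append [simp]: "endpoint (v @ w) = endpoint v + endpoint w"
  by (simp add: endpoint_def pos_def)

text \<open>This is the reason for \<open>steps_at\<close>: concatenation becomes union, so the two
  paths of the theorem share all steps outside the exchanged pair.\<close>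

lemma steps_at_append [simp]:
  "steps_at p (v @ w) = steps_at p v \<union> steps_at (p + endpoint v) w"
  by (induction v arbitrary: p) (auto simp: add.assoc)

lemma pos_0 [simp]: "pos w 0 = 0"
  by (simp add: pos_def)

lemma pos_Suc_Cons: "pos (s # w) (Suc i) = step_vec s + pos w i"
  by (simp add: pos_def)

lemma pos_Suc: "i < length w \<Longrightarrow> pos w (Suc i) = pos w i + step_vec (w ! i)"
  by (simp add: pos_def take_Suc_conv_app_nth)

lemma steps_at_iff:
  "(r, s) \<in> steps_at p w \<longleftrightarrow> (\<exists>i<length w. r = p + pos w i \<and> s = w ! i)"
proof (induction w arbitrary: p)
  case (Cons t w)
  have "(\<exists>i<length (t # w). r = p + pos (t # w) i \<and> s = (t # w) ! i) \<longleftrightarrow>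
      (r = p \<and> s = t) \<or> (\<exists>i<length w. r = p + step_vec t + pos w i \<and> s = w ! i)"
    unfolding length_Cons Ex_less_Suc2 by (simp add: pos_Suc_Cons add.assoc)
  with Cons show ?case by simp
qed simp

lemma step_vec_nonneg: "0 \<le> fst (step_vec s)" "0 \<le> snd (step_vec s)"
  by (cases s; simp)+

lemma endpoint_nonneg: "0 \<le> fst (endpoint w)" "0 \<le> snd (endpoint w)"
  by (induction w) (simp_all add: step_vec_nonneg)

text \<open>Coordinates never decrease along a word, so each step stays in the rectangle spanned by
  start and end. This later separates the steps of \<open>U\<close>, \<open>V\<close> and
  \<open>W\<close>.\<close>

lemma steps_at_bounds:
  assumes "(r, s) \<in> steps_at p w"
  shows "fst p \<le> fst r" "snd p \<le> snd r"
    "fst r + fst (step_vec s) \<le> fst p + fst (endpoint w)"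
    "snd r + snd (step_vec s) \<le> snd p + snd (endpoint w)"
proof -
  have "fst p \<le> fst r \<and> snd p \<le> snd r \<and>
      fst r + fst (step_vec s) \<le> fst p + fst (endpoint w) \<and>
      snd r + snd (step_vec s) \<le> snd p + snd (endpoint w)"
    using assms
  proof (induction w arbitrary: p)
    case (Cons t w)
    show ?case
    proof (cases "(r, s) \<in> steps_at (p + step_vec t) w")
      case True
      from Cons.IH[OF True] show ?thesis using step_vec_nonneg[of t] by simp
    next
      case False
      with Cons.prems show ?thesis using endpoint_nonneg[of w] by simp
    qed
  qed simp
  then show "fst p \<le> fst r" "snd p \<le> snd r"
    "fst r + fst (step_vec s) \<le> fst p + fst (endpoint w)"
    "snd r + snd (step_vec s) \<le> snd p + snd (endpoint w)" by simp_all
qed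

section \<open>Edges of the graph in terms of steps\<close>

lemma strict_edges_steps:
  "strict_edges n P = {(a, b). 1 \<le> a \<and> a < b \<and> b \<le> n \<and>
     ((int a - 1, int b - 1), Diag) \<in> steps_at 0 P}"
  unfolding strict_edges_def steps_at_iff by (auto; metis)

lemma path_curve_iff:
  "c \<in> path_curve P \<longleftrightarrow> (\<exists>g h s l. ((g, h), s) \<in> steps_at 0 P \<and> 0 \<le> l \<and> l \<le> 1 \<and>
     c = (real_of_int g + l * real_of_int (fst (step_vec s)),
          real_of_int h + l * real_of_int (snd (step_vec s))))"
proof -
  have seg: "c \<in> closed_segment (map_prod of_int of_int (pos P i))
        (map_prod of_int of_int (pos P (Suc i))) \<longleftrightarrow>
      (\<exists>l. 0 \<le> l \<and> l \<le> 1 \<and>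
        c = (real_of_int (fst (pos P i)) + l * real_of_int (fst (step_vec (P ! i))),
             real_of_int (snd (pos P i)) + l * real_of_int (snd (step_vec (P ! i)))))"
    if "i < length P" for i
    using that
    by (cases "pos P i"; cases "step_vec (P ! i)"; cases c)
       (auto simp: closed_segment_def pos_Suc algebra_simps)
  show ?thesis
    unfolding path_curve_def steps_at_iff
    using seg by (force simp: prod_eq_iff)
qed

text \<open>Above column \<open>a\<close> the path is an east or diagonal step starting at some
  height \<open>h\<close>, and the lowest point of that step decides which unit squares fit below
  it.\<close>

lemma nonstrict_edges_steps:
  "nonstrict_edges n P = {(a, b). 1 \<le> a \<and> a < b \<and> b \<le> n \<and>
     (\<exists>h s. ((int a - 1, h), s) \<in> steps_at 0 P \<and> s \<noteq> North \<and> int b \<le> h)}"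
proof -
  have "{real a - 1..real a} \<times> {real b - 1..real b} \<subseteq> region P \<longleftrightarrow>
      (\<exists>h s. ((int a - 1, h), s) \<in> steps_at 0 P \<and> s \<noteq> North \<and> int b \<le> h)"
    (is "?L \<longleftrightarrow> ?R") if "1 \<le> a" "a < b" for a b
  proof
    assume ?L
    \<comment> \<open>The midpoint of the top side suffices: its half-integral abscissa rules out
      north steps and forces \<open>l = 1/2\<close>. The path then has height at most
      \<open>h + 1/2\<close> there, so integrality gives \<open>b \<le> h\<close>.\<close>
    moreover have "(real a - 1/2, real b) \<in> {real a - 1..real a} \<times> {real b - 1..real b}" by simp
    ultimately have "(real a - 1/2, real b) \<in> region P" by blast
    then obtain t where t: "real b \<le> t" "(real a - 1/2, t) \<in> path_curve P"
      by (auto simp: region_def)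
    then obtain g h s l where st: "((g, h), s) \<in> steps_at 0 P" "0 \<le> l" "l \<le> 1"
      "real a - 1/2 = real_of_int g + l * real_of_int (fst (step_vec s))"
      "t = real_of_int h + l * real_of_int (snd (step_vec s))"
      unfolding path_curve_iff by blast
    have "s \<noteq> North"
    proof
      assume "s = North"
      with st have "real_of_int (2 * int a - 1) = real_of_int (2 * g)" by simp
      then have "2 * int a - 1 = 2 * g" by (simp only: of_int_eq_iff)
      then show False by presburger
    qed
    then have l: "real a - 1/2 = real_of_int g + l" using st(4) by (cases s) auto
    have "real_of_int (int a - 1) < real_of_int (g + 1)" "real_of_int g < real_of_int (int a)"
      using l st(2,3) by simp_all
    then have g: "g = int a - 1" by linarith
    have "l = 1/2" using l g by simp
    then have "real_of_int (int b) < real_of_int (h + 1)"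
      using t(1) st(5) \<open>s \<noteq> North\<close> by (cases s) auto
    then have "int b \<le> h" by linarith
    with g st(1) \<open>s \<noteq> North\<close> show ?R by blast
  next
    assume ?R
    then obtain h s where h: "((int a - 1, h), s) \<in> steps_at 0 P" "s \<noteq> North" "int b \<le> h" by blast
    then have vec: "fst (step_vec s) = 1" "0 \<le> snd (step_vec s)" by (cases s; simp)+
    show ?L
    proof
      fix c assume "c \<in> {real a - 1..real a} \<times> {real b - 1..real b}"
      then obtain v t where c: "c = (v, t)" "real a - 1 \<le> v" "v \<le> real a" "real b - 1 \<le> t" "t \<le> real b"
        by auto
      define t' where "t' = real_of_int h + (v - (real a - 1)) * real_of_int (snd (step_vec s))"
      have "(v, t') \<in> path_curve P"
        unfolding path_curve_iff
        by (rule exI[of _ "int a - 1"], rule exI[of _ h], rule exI[of _ s],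
            rule exI[of _ "v - (real a - 1)"])
          (use h c vec in \<open>auto simp: t'_def\<close>)
      moreover have "real_of_int h \<le> t'" using c vec by (simp add: t'_def)
      moreover have "real b \<le> real_of_int h" using h(3) by linarith
      \<comment> \<open>The square is above the diagonal since
        \<open>v \<le> a \<le> b - 1 \<le> t\<close>.\<close>
      moreover have "v \<le> t" using c that by linarith
      ultimately show "c \<in> region P"
        using c unfolding region_def by (auto intro!: exI[of _ t'])
    qed
  qed
  then show ?thesis unfolding nonstrict_edges_def by auto
qed

lemma finite_nonstrict_edges: "finite (nonstrict_edges n P)"
  by (rule finite_subset[of _ "{..n} \<times> {..n}"]) (auto simp: nonstrict_edges_def)

section \<open>Paths with a single bounce point\<close>

lemma pos_eq_counts:
  "pos w i = (int (count_list (take i w) East) + int (count_list (take i w) Diag),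
              int (count_list (take i w) North) + int (count_list (take i w) Diag))"
proof (induction w arbitrary: i)
  case (Cons s w)
  then show ?case by (cases i; cases s) (simp_all add: pos_Suc_Cons zero_prod_def)
qed (simp add: pos_def zero_prod_def)

text \<open>Bounce points form a set, so repetitions must be excluded. If \<open>u 1 = u 2\<close>,
  a diagonal step of \<open>P\<close> would start on the line y = x, where north and east counts
  agree, against the Schroeder condition.\<close>

lemma bounce_path_one_point:
  assumes "schroeder_path n P" "bounce_path P p k u" "card (bounce_points k u) = 1"
  shows "k = 1"
proof (rule ccontr)
  assume "k \<noteq> 1"
  with assms(2) have k: "2 \<le> k" by (auto simp: bounce_path_def)
  then have "(u 1, u 1) \<in> bounce_points k u" "(u 2, u 2) \<in> bounce_points k u"
    unfolding bounce_points_def by auto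
  with assms(3) have "u 1 = u 2" by (metis card_1_singletonE prod.inject singletonD)
  moreover have "\<forall>i\<in>{1..<k}. between_diags P (u (i + 1), u i)"
    using assms(2) by (simp add: bounce_path_def)
  then have "between_diags P (u (1 + 1), u 1)" by (rule bspec) (use k in simp)
  ultimately obtain i where i: "Suc i < length P" "P ! Suc i = Diag" "pos P (Suc i) = (u 1, u 1)"
    by (auto simp: between_diags_def numeral_2_eq_2)
  from i(3) have "count_list (take (Suc i) P) North = count_list (take (Suc i) P) East"
    by (simp add: pos_eq_counts)
  with assms(1) i(1,2) show False by (auto simp: schroeder_path_def)
qed

section \<open>Exchanging the colors of two adjacent vertices\<close>

lemma card_ascents_involution:
  fixes \<kappa> :: "'a \<Rightarrow> nat"
  assumes "\<And>a. t (t a) = a" "\<And>a b. (a, b) \<in> E \<Longrightarrow> (t a, t b) \<in> E"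
  shows "card {(a, b) \<in> E. \<kappa> (t a) < \<kappa> (t b)} = card {(a, b) \<in> E. \<kappa> a < \<kappa> b}"
  by (rule bij_betw_same_card
      [OF bij_betw_byWitness[where f = "map_prod t t" and f' = "map_prod t t"]])
    (auto simp: assms(1) dest: assms(2))

lemma asc_insert:
  assumes "nonstrict_edges n P = insert (a, b) E" "(a, b) \<notin> E"
  shows "asc n P \<kappa> = (if \<kappa> a < \<kappa> b then 1 else 0) + card {(a, b) \<in> E. \<kappa> a < \<kappa> b}"
proof -
  have "{(i, j) \<in> insert (a, b) E. \<kappa> i < \<kappa> j} =
      (if \<kappa> a < \<kappa> b then insert (a, b) {(i, j) \<in> E. \<kappa> i < \<kappa> j} else {(i, j) \<in> E. \<kappa> i < \<kappa> j})"
    by auto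
  moreover have "finite {(i, j) \<in> E. \<kappa> i < \<kappa> j}"
    by (rule finite_subset[OF _ finite_nonstrict_edges[of n P]]) (use assms in auto)
  ultimately show ?thesis using assms by (simp add: asc_def)
qed

text \<open>Paths enter only through their edge sets. \<open>D\<close> holds the common strict
  edges, all away from \<open>c\<close> and \<open>Suc c\<close>. In \<open>sym\<close> the pair
  \<open>(c, Suc c)\<close> is left out because the transposition reverses it.\<close>

lemma G_series_transfer:
  fixes c z :: nat
  assumes c: "1 \<le> c" "Suc c < z" "z \<le> n"
    and nonstrict: "nonstrict_edges n P = insert (Suc c, z) (nonstrict_edges n Q)"
      "(Suc c, z) \<notin> nonstrict_edges n Q"
    and strict: "strict_edges n P = insert (c, z) D" "strict_edges n Q = insert (Suc c, z) D"
    and D: "\<And>a b. (a, b) \<in> D \<Longrightarrow> a \<notin> {c, Suc c} \<and> b \<notin> {c, Suc c}"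
    and edge: "(c, Suc c) \<in> nonstrict_edges n Q"
    and sym: "\<And>a b. (a, b) \<in> nonstrict_edges n Q - {(c, Suc c)} \<Longrightarrow>
      map_prod (Transposition.transpose c (Suc c)) (Transposition.transpose c (Suc c)) (a, b)
        \<in> nonstrict_edges n Q - {(c, Suc c)}"
  shows "G_series n P m = monom 1 1 * G_series n Q m"
proof -
  let ?t = "Transposition.transpose c (Suc c)"
  let ?K = "\<lambda>R. {\<kappa> \<in> colorings n R. image_mset \<kappa> (mset_set {1..n}) = m}"
  define E where "E = nonstrict_edges n Q - {(c, Suc c)}"
  \<comment> \<open>Each map tests the inequality that its source does not guarantee. A swap turns
    failure of one test into failure of the other, so the maps are mutually inverse.\<close>
  define \<phi> where "\<phi> \<kappa> = (if \<kappa> (Suc c) < \<kappa> z then \<kappa> else \<kappa> \<circ> ?t)" for \<kappa> :: "nat \<Rightarrow> nat"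
  define \<psi> where "\<psi> \<kappa> = (if \<kappa> c < \<kappa> z then \<kappa> else \<kappa> \<circ> ?t)" for \<kappa> :: "nat \<Rightarrow> nat"
  have tz [simp]: "?t z = z" using c by (simp add: Transposition.transpose_def)
  have t_D: "?t a = a" "?t b = b" if "(a, b) \<in> D" for a b
    using D[OF that] by (auto simp: Transposition.transpose_def)
  have t_image: "?t ` {1..n} = {1..n}" using c by (simp add: transpose_image_eq)
  have mset: "image_mset (\<kappa> \<circ> ?t) (mset_set {1..n}) = image_mset \<kappa> (mset_set {1..n})"
    for \<kappa> :: "nat \<Rightarrow> nat"
  proof -
    have "image_mset ?t (mset_set {1..n}) = mset_set (?t ` {1..n})"
      by (rule image_mset_mset_set) (rule inj_on_subset[OF inj_transpose], simp)
    then show ?thesis by (metis t_image multiset.map_comp)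
  qed
  have t_PiE: "\<kappa> \<circ> ?t \<in> {1..n} \<rightarrow>\<^sub>E {0<..}" if "\<kappa> \<in> {1..n} \<rightarrow>\<^sub>E {0<..}" for \<kappa> :: "nat \<Rightarrow> nat"
  proof (rule PiE_I)
    fix i assume "i \<in> {1..n}"
    then have "?t i \<in> {1..n}" using t_image by blast
    with that show "(\<kappa> \<circ> ?t) i \<in> {0<..}" by (auto simp: PiE_iff)
  next
    fix i assume "i \<notin> {1..n}"
    \<comment> \<open>Colorings are \<open>undefined\<close> outside \<open>{1..n}\<close>; both
      exchanged vertices lie inside, so this default survives.\<close>
    moreover from this have "?t i = i" using c by (auto simp: Transposition.transpose_def)
    ultimately show "(\<kappa> \<circ> ?t) i = undefined" using that by (auto simp: PiE_iff extensional_def)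
  qed
  have col_P: "\<kappa> \<in> colorings n P \<longleftrightarrow>
      \<kappa> \<in> {1..n} \<rightarrow>\<^sub>E {0<..} \<and> \<kappa> c < \<kappa> z \<and> (\<forall>(a, b)\<in>D. \<kappa> a < \<kappa> b)" for \<kappa>
    by (auto simp: colorings_def strict)
  have col_Q: "\<kappa> \<in> colorings n Q \<longleftrightarrow>
      \<kappa> \<in> {1..n} \<rightarrow>\<^sub>E {0<..} \<and> \<kappa> (Suc c) < \<kappa> z \<and> (\<forall>(a, b)\<in>D. \<kappa> a < \<kappa> b)" for \<kappa>
    by (auto simp: colorings_def strict)
  have t_strict: "\<forall>(a, b)\<in>D. (\<kappa> \<circ> ?t) a < (\<kappa> \<circ> ?t) b" if "\<forall>(a, b)\<in>D. \<kappa> a < \<kappa> b"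
    for \<kappa> :: "nat \<Rightarrow> nat"
    using that t_D by fastforce
  have asc_P: "asc n P \<kappa> = (if \<kappa> (Suc c) < \<kappa> z then 1 else 0) + asc n Q \<kappa>" for \<kappa>
    using asc_insert[OF nonstrict] by (simp add: asc_def)
  have asc_Q: "asc n Q \<kappa> = (if \<kappa> c < \<kappa> (Suc c) then 1 else 0) + card {(a, b) \<in> E. \<kappa> a < \<kappa> b}"
    for \<kappa>
    by (rule asc_insert) (use edge in \<open>auto simp: E_def\<close>)
  have t_E: "card {(a, b) \<in> E. (\<kappa> \<circ> ?t) a < (\<kappa> \<circ> ?t) b} = card {(a, b) \<in> E. \<kappa> a < \<kappa> b}"
    for \<kappa> :: "nat \<Rightarrow> nat"
    using card_ascents_involution[of ?t E \<kappa>] sym by (simp add: E_def)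
  \<comment> \<open>In the swapped case
    \<open>\<kappa> c < \<kappa> z \<le> \<kappa> (Suc c)\<close>, so \<open>(c, Suc c)\<close> is
    an ascent before the swap and not after it.\<close>
  have asc_\<phi>: "asc n P \<kappa> = 1 + asc n Q (\<phi> \<kappa>)" if "\<kappa> \<in> colorings n P" for \<kappa>
    using that by (auto simp: asc_P asc_Q \<phi>_def col_P t_E simp del: comp_apply)
       (auto)
  have "(\<Sum>\<kappa>\<in>?K P. monom 1 (asc n P \<kappa>)) = (\<Sum>\<kappa>\<in>?K Q. monom (1::int) 1 * monom 1 (asc n Q \<kappa>))"
  proof (rule sum.reindex_bij_witness[of _ \<psi> \<phi>])
    fix \<kappa> assume "\<kappa> \<in> ?K P"
    then have \<kappa>: "\<kappa> \<in> colorings n P" "image_mset \<kappa> (mset_set {1..n}) = m" by auto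
    then show "\<psi> (\<phi> \<kappa>) = \<kappa>" by (auto simp: \<phi>_def \<psi>_def col_P fun_eq_iff)
    have "\<phi> \<kappa> \<in> colorings n Q"
    proof (cases "\<kappa> (Suc c) < \<kappa> z")
      case True
      then show ?thesis using \<kappa>(1) by (simp add: \<phi>_def col_P col_Q)
    next
      case False
      then show ?thesis using \<kappa>(1) t_strict[of \<kappa>] t_PiE[of \<kappa>] unfolding \<phi>_def col_P col_Q by simp
    qed
    with \<kappa>(2) show "\<phi> \<kappa> \<in> ?K Q" using mset[of \<kappa>] by (simp add: \<phi>_def)
    show "monom 1 1 * monom 1 (asc n Q (\<phi> \<kappa>)) = monom (1::int) (asc n P \<kappa>)"
      by (simp add: mult_monom asc_\<phi>[OF \<kappa>(1)])
  next
    fix \<kappa> assume "\<kappa> \<in> ?K Q"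
    then have \<kappa>: "\<kappa> \<in> colorings n Q" "image_mset \<kappa> (mset_set {1..n}) = m" by auto
    then show "\<phi> (\<psi> \<kappa>) = \<kappa>" by (auto simp: \<phi>_def \<psi>_def col_Q fun_eq_iff)
    have "\<psi> \<kappa> \<in> colorings n P"
    proof (cases "\<kappa> c < \<kappa> z")
      case True
      then show ?thesis using \<kappa>(1) by (simp add: \<psi>_def col_P col_Q)
    next
      case False
      then show ?thesis using \<kappa>(1) t_strict[of \<kappa>] t_PiE[of \<kappa>] unfolding \<psi>_def col_P col_Q by simp
    qed
    with \<kappa>(2) show "\<psi> \<kappa> \<in> ?K P" using mset[of \<kappa>] by (simp add: \<psi>_def)
  qed
  then show ?thesis by (simp add: G_series_def sum_distrib_left)
qed

section \<open>Comparison of the two paths\<close>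

theorem theorem4p4:
  fixes n k :: nat and P U V W :: "step list" and x z :: int and u :: "nat \<Rightarrow> int"
  assumes "schroeder_path n P"
    and "(x, z) \<in> lattice_points P"
    and "z > x + 1"
    and "bounce_path P (x, z) k u"
    and "card (bounce_points k u) = 1"
    and "bounce_decomposition P k u U North North V Diag East W"
  shows "G_series n P =
    (\<lambda>m. monom 1 1 * G_series n (U @ [North, North] @ V @ [East, Diag] @ W) m)"
proof -
  define Q where "Q = U @ [North, North] @ V @ [East, Diag] @ W"
  have k: "k = 1" by (rule bounce_path_one_point[OF assms(1,4,5)])
  \<comment> \<open>With \<open>k = 1\<close> the bounce path stops at
    \<open>(u 2, u 1) = (y, x)\<close>, the point between the two marked north steps.\<close>
  define y where "y = u 2"
  have u: "u 1 = x" "u 0 = z" using assms(4) by (auto simp: bounce_path_def)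
  have P: "P = U @ [North] @ [North] @ V @ [Diag] @ [East] @ W"
    and end1: "endpoint (U @ [North]) = (y, x)"
    and end2: "endpoint (U @ [North] @ [North] @ V @ [Diag]) = (x, z)"
    using assms(6) k u by (simp_all add: bounce_decomposition_def y_def numeral_2_eq_2)
  have endU: "endpoint U = (y, x - 1)" using end1 by (cases "endpoint U") (simp add: zero_prod_def)
  have endV: "endpoint V = (x - 1 - y, z - 2 - x)"
    using end2 endU by (cases "endpoint V") (simp add: zero_prod_def)
  have "endpoint P = (int n, int n)" using assms(1) by (simp add: schroeder_path_def)
  then have endW: "endpoint W = (int n - x - 1, int n - z)"
    using endU endV P by (cases "endpoint W") (simp add: zero_prod_def)
  have bounds: "0 \<le> y" "y < x" "z \<le> int n"
    using endpoint_nonneg[of U] endpoint_nonneg[of V] endpoint_nonneg[of W] endU endV endW by auto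
  define A where "A = steps_at 0 U"
  define B where "B = steps_at (y, x + 1) V"
  define C where "C = steps_at (x + 1, z) W"
  have steps_P: "steps_at 0 P = A \<union> {((y, x - 1), North), ((y, x), North)} \<union> B \<union>
      {((x - 1, z - 1), Diag), ((x, z), East)} \<union> C"
    using endU endV unfolding P A_def B_def C_def by (auto simp: zero_prod_def)
  have steps_Q: "steps_at 0 Q = A \<union> {((y, x - 1), North), ((y, x), North)} \<union> B \<union>
      {((x - 1, z - 1), East), ((x, z - 1), Diag)} \<union> C"
    using endU endV unfolding Q_def A_def B_def C_def by (auto simp: zero_prod_def)
  \<comment> \<open>By these bounds no east or diagonal step of \<open>U\<close>, \<open>V\<close>
    or \<open>W\<close> starts at abscissa \<open>x - 1\<close> or \<open>x\<close>: columns
    \<open>c\<close> and \<open>Suc c\<close> see only the exchanged steps.\<close>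
  have A: "g + fst (step_vec s) \<le> y \<and> h + snd (step_vec s) \<le> x - 1" if "((g, h), s) \<in> A" for g h s
    using steps_at_bounds[OF that[unfolded A_def]] endU by simp
  have B: "y \<le> g \<and> x + 1 \<le> h \<and> g + fst (step_vec s) \<le> x - 1" if "((g, h), s) \<in> B" for g h s
    using steps_at_bounds[OF that[unfolded B_def]] endV by simp
  have C: "x + 1 \<le> g \<and> z \<le> h" if "((g, h), s) \<in> C" for g h s
    using steps_at_bounds[OF that[unfolded C_def]] by simp
  define c where "c = nat x"
  define e where "e = nat z"
  have x: "x = int c" and z: "z = int e" using bounds assms(3) by (auto simp: c_def e_def)
  have east: "fst (step_vec s) = 1" "0 \<le> snd (step_vec s)" if "s \<noteq> North" for s
    using that by (cases s; simp)+
  \<comment> \<open>\<open>D\<close> and \<open>H\<close> record what the common steps contribute to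
    strict and non-strict edges.\<close>
  define D where "D = {(a, b). 1 \<le> a \<and> a < b \<and> b \<le> n \<and>
     ((int a - 1, int b - 1), Diag) \<in> A \<union> B \<union> C}"
  define H where "H a b \<longleftrightarrow> (\<exists>h s. ((int a - 1, h), s) \<in> A \<union> B \<union> C \<and> s \<noteq> North \<and> int b \<le> h)"
    for a b :: nat
  have strict_P: "strict_edges n P = insert (c, e) D"
    unfolding strict_edges_steps steps_P D_def x z using bounds assms(3) x z by auto
  have strict_Q: "strict_edges n Q = insert (Suc c, e) D"
    unfolding strict_edges_steps steps_Q D_def x z using bounds assms(3) x z by auto
  have D: "a \<notin> {c, Suc c} \<and> b \<notin> {c, Suc c}" if "(a, b) \<in> D" for a b
  proof -
    have "((int a - 1, int b - 1), Diag) \<in> A \<union> B \<union> C" using that by (simp add: D_def)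
    then show ?thesis using A B C bounds assms(3) x by fastforce
  qed
  \<comment> \<open>In \<open>P\<close> the diagonal step starts at height \<open>z - 1\<close> and
    the east step at \<open>z\<close>, hence \<open>b < e\<close> against \<open>b \<le> e\<close>.
    In \<open>Q\<close> both steps start at height \<open>z - 1\<close>.\<close>
  have nonstrict_P: "(a, b) \<in> nonstrict_edges n P \<longleftrightarrow> 1 \<le> a \<and> a < b \<and> b \<le> n \<and>
      (H a b \<or> (a = c \<and> b < e) \<or> (a = Suc c \<and> b \<le> e))" for a b
    unfolding nonstrict_edges_steps steps_P H_def x z
    by (auto simp: conj_disj_distribR ex_disj_distrib)
  have nonstrict_Q: "(a, b) \<in> nonstrict_edges n Q \<longleftrightarrow> 1 \<le> a \<and> a < b \<and> b \<le> n \<and>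
      (H a b \<or> (a = c \<and> b < e) \<or> (a = Suc c \<and> b < e))" for a b
    unfolding nonstrict_edges_steps steps_Q H_def x z
    by (auto simp: conj_disj_distribR ex_disj_distrib)
  have H_col: "\<not> H c b" "\<not> H (Suc c) b" for b
    unfolding H_def using A B C east bounds x by fastforce+
  have H_row: "H a c \<longleftrightarrow> H a (Suc c)" for a
  proof
    assume "H a c"
    then obtain h s where h: "((int a - 1, h), s) \<in> A \<union> B \<union> C" "s \<noteq> North" "x \<le> h"
      by (auto simp: H_def x)
    \<comment> \<open>No common step starts at height \<open>x\<close>: those of \<open>U\<close>
      end by height \<open>x - 1\<close>, and those of \<open>V\<close> and \<open>W\<close> start
      at \<open>x + 1\<close> or higher.\<close>
    then have "x + 1 \<le> h" using A B C east assms(3) by fastforce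
    then have "int (Suc c) \<le> h" using x by simp
    with h show "H a (Suc c)" unfolding H_def by blast
  next
    have "int c \<le> h" if "int (Suc c) \<le> h" for h using that by simp
    then show "H a (Suc c) \<Longrightarrow> H a c" unfolding H_def by blast
  qed
  have ce: "1 \<le> c" "Suc c < e" "e \<le> n" using bounds assms(3) x z by auto
  show ?thesis
    unfolding Q_def[symmetric]
  proof (rule ext, rule G_series_transfer[OF ce _ _ strict_P strict_Q D])
    show "nonstrict_edges n P = insert (Suc c, e) (nonstrict_edges n Q)"
      using ce by (auto simp: nonstrict_P nonstrict_Q)
    show "(Suc c, e) \<notin> nonstrict_edges n Q" by (simp add: nonstrict_Q H_col)
    show "(c, Suc c) \<in> nonstrict_edges n Q" using ce by (simp add: nonstrict_Q)
    \<comment> \<open>In \<open>Q\<close> the columns \<open>c\<close> and \<open>Suc c\<close> both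
      have the bound \<open>b < e\<close>, and \<open>H_row\<close> identifies the rows
      \<open>c\<close> and \<open>Suc c\<close>.\<close>
    show "map_prod (Transposition.transpose c (Suc c)) (Transposition.transpose c (Suc c)) (a, b)
        \<in> nonstrict_edges n Q - {(c, Suc c)}"
      if "(a, b) \<in> nonstrict_edges n Q - {(c, Suc c)}" for a b
      using that ce H_col H_row
      by (auto simp: nonstrict_Q Transposition.transpose_def split: if_splits)
  qed
qed

end
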